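(* Let $A\in\mathbb{R}^{n\times n}$, and let $\mathcal{E}=\{x\in\mathbb{R}^n : x^TQx\le 1\}$ be an ellipsoid, where $Q\in\mathbb{R}^{n\times n}$ is symmetric positive definite. Assume that $\mathcal{E}$ is an invariant set for the continuous system $\dot{x}(t)=Ax(t)$. Let $\bar\tau=\sup\{\tau : I-A\Delta t \text{ is nonsingular for every } \Delta t\in[0,\tau]\}$. Then $\bar\tau=\infty$, and thus for every $x_k\in\mathcal{E}$ and every $\Delta t\ge0$, we have $x_{k+1}\in\mathcal{E}$, where $x_{k+1}=(I-\Delta t A)^{-1}x_k$ is obtained by the backward Euler method; i.e., $\mathcal{E}$ is an invariant set for the discrete system $x_{k+1}=(I-\Delta t A)^{-1}x_k$.
   Context: A set $\mathcal{S}$ is an invariant set for $\dot x(t)=Ax(t)$ if $x(0)\in\mathcal{S}$ implies $x(t)\in\mathcal{S}$ for all $t\ge0$. It is an invariant set for a discrete system $x_{k+1}=Mx_k$ if $x_k\in\mathcal{S}$ implies $x_{k+1}\in\mathcal{S}$ for all $k\in\mathbb{N}$. In the definition of $\bar\tau$, $\tau$ ranges over nonnegative reals. *)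

theory Defs
  imports "HOL-Analysis.Analysis"
begin

definition symmetric_matrix :: "real ^ 'n ^ 'n \<Rightarrow> bool" where
  "symmetric_matrix Q \<longleftrightarrow> transpose Q = Q"

definition positive_definite :: "real ^ 'n ^ 'n \<Rightarrow> bool" where
  "positive_definite Q \<longleftrightarrow> (\<forall>x. x \<noteq> 0 \<longrightarrow> x \<bullet> (Q *v x) > 0)"

definition ellipsoid :: "real ^ 'n ^ 'n \<Rightarrow> (real ^ 'n) set" where
  "ellipsoid Q = {x. x \<bullet> (Q *v x) \<le> 1}"

text \<open>A trajectory lives on the half-line $[0,\infty)$: the derivative at time 0 is one-sided,
  and the values at negative times are irrelevant.\<close>

definition continuous_trajectory :: "real ^ 'n ^ 'n \<Rightarrow> (real \<Rightarrow> real ^ 'n) \<Rightarrow> bool" where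
  "continuous_trajectory A x \<longleftrightarrow>
     (\<forall>t\<ge>0. (x has_vector_derivative A *v x t) (at t within {0..}))"

definition continuous_invariant :: "real ^ 'n ^ 'n \<Rightarrow> (real ^ 'n) set \<Rightarrow> bool" where
  "continuous_invariant A S \<longleftrightarrow>
     (\<forall>x. continuous_trajectory A x \<longrightarrow> x 0 \<in> S \<longrightarrow> (\<forall>t\<ge>0. x t \<in> S))"

definition discrete_trajectory :: "real ^ 'n ^ 'n \<Rightarrow> (nat \<Rightarrow> real ^ 'n) \<Rightarrow> bool" where
  "discrete_trajectory M x \<longleftrightarrow> (\<forall>k. x (Suc k) = M *v x k)"

definition discrete_invariant :: "real ^ 'n ^ 'n \<Rightarrow> (real ^ 'n) set \<Rightarrow> bool" where
  "discrete_invariant M S \<longleftrightarrow>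
     (\<forall>x. discrete_trajectory M x \<longrightarrow> (\<forall>k. x k \<in> S \<longrightarrow> x (Suc k) \<in> S))"

text \<open>The supremum is taken in the extended reals, so that it may be infinite.\<close>

definition tau_bar :: "real ^ 'n ^ 'n \<Rightarrow> ereal" where
  "tau_bar A =
     Sup (ereal ` {\<tau>. 0 \<le> \<tau> \<and> (\<forall>\<Delta>t\<in>{0..\<tau>}. invertible (mat 1 - \<Delta>t *\<^sub>R A))})"

text \<open>Since \<^const>\<open>matrix_inv\<close> is total, this is the backward Euler matrix only where
  \<^term>\<open>mat 1 - \<Delta>t *\<^sub>R A\<close> is invertible.\<close>

definition backward_euler :: "real ^ 'n ^ 'n \<Rightarrow> real \<Rightarrow> real ^ 'n ^ 'n" where
  "backward_euler A \<Delta>t = matrix_inv (mat 1 - \<Delta>t *\<^sub>R A)"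

end

theory Submission
  imports Defs
begin

text \<open>
  The quadratic form \<open>V(x) = x \<bullet> Q x\<close> turns invariance into an algebraic inequality.  The proof
  passes from \<open>\<E>\<close> to the \<^emph>\<open>dissipation inequality\<close> \<open>x \<bullet> Q A x \<le> 0\<close> for all \<open>x\<close>, and from there to
  the backward Euler step.

  Necessity of the inequality (\<open>invariant_ellipsoid_imp_dissipative\<close>): by homogeneity it suffices
  to take \<open>V(x) = 1\<close>.  The trajectory \<open>exp(tA) x\<close> starts on the boundary of \<open>\<E>\<close>, and along it
  \<open>V\<close> has derivative \<open>2 x \<bullet> Q A x\<close> at time 0; were this positive, the trajectory would leave \<open>\<E>\<close>
  at once.  Invariance says something only about trajectories that exist, so \<open>exp(tA) x\<close> has to be
  constructed; this is the analytic part of the proof (\<open>exp_trajectory_exists\<close>).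

  Sufficiency (\<open>dissipative_imp_le_resolvent\<close>): for \<open>h \<ge> 0\<close>, expanding the square gives
  \<open>V(y - h A y) = V(y) - 2 h (y \<bullet> Q A y) + h\<^sup>2 V(A y) \<ge> V(y)\<close>.
  So \<open>I - h A\<close> is injective because \<open>V\<close> is definite, hence invertible for every \<open>h \<ge> 0\<close>, and its
  inverse does not increase \<open>V\<close>, so it maps \<open>\<E>\<close> into itself.
\<close>

text \<open>
  The solution is the everywhere convergent power series with coefficients
  \<open>c k = A\<^sup>k x\<^sub>0 / k!\<close>.  They are defined through their recursion, because
  \<open>(k + 1) c (k + 1) = A c k\<close> is exactly what termwise differentiation needs.  The
  argument runs componentwise, so that the theory of real power series applies.
\<close>

lemma exp_trajectory_exists:
  fixes A :: "real ^ 'n ^ 'n" and x0 :: "real ^ 'n"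
  obtains x where "x 0 = x0"
    and "\<And>t. (x has_vector_derivative A *v x t) (at t)"
proof -
  define c where "c = rec_nat x0 (\<lambda>k v. (1 / real (Suc k)) *\<^sub>R (A *v v))"
  have c0: "c 0 = x0" and cS: "c (Suc k) = (1 / real (Suc k)) *\<^sub>R (A *v c k)" for k
    by (simp_all add: c_def)
  obtain B where B: "\<And>v. norm (A *v v) \<le> B * norm v" "B > 0"
    using bounded_linear.pos_bounded[OF matrix_vector_mul_bounded_linear[of A]]
    by (metis mult.commute)
  have bound: "norm (c k) \<le> B ^ k / fact k * norm x0" for k
  proof (induction k)
    case (Suc k)
    have "norm (c (Suc k)) = norm (A *v c k) / real (Suc k)"
      by (simp add: cS)
    also have "\<dots> \<le> B * norm (c k) / real (Suc k)"
      by (intro divide_right_mono B) simp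
    also have "\<dots> \<le> B * (B ^ k / fact k * norm x0) / real (Suc k)"
      using B(2) Suc by (intro divide_right_mono mult_left_mono) auto
    finally show ?case by (simp add: field_simps)
  qed (simp add: c0)
  have summ: "summable (\<lambda>k. c k $ i * t ^ k)" for i t
  proof (rule summable_comparison_test')
    show "summable (\<lambda>k. norm x0 * (inverse (fact k) * (B * \<bar>t\<bar>) ^ k))"
      by (intro summable_mult summable_exp)
    show "norm (c k $ i * t ^ k) \<le> norm x0 * (inverse (fact k) * (B * \<bar>t\<bar>) ^ k)" for k
    proof -
      have "norm (c k $ i * t ^ k) = \<bar>c k $ i\<bar> * \<bar>t\<bar> ^ k"
        by (simp add: abs_mult power_abs)
      also have "\<dots> \<le> (B ^ k / fact k * norm x0) * \<bar>t\<bar> ^ k"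
        using component_le_norm_cart[of "c k" i] bound[of k]
        by (intro mult_right_mono) auto
      finally show ?thesis by (simp add: field_simps power_mult_distrib)
    qed
  qed
  define x where "x t = (\<chi> i. \<Sum>k. c k $ i * t ^ k)" for t
  have diffs_c: "diffs (\<lambda>k. c k $ i) k = (A *v c k) $ i" for i k
    by (simp add: diffs_def cS del: of_nat_Suc)
  have deriv_sum: "(\<Sum>k. diffs (\<lambda>k. c k $ i) k * t ^ k) = (A *v x t) $ i" for i t
  proof -
    have "(\<Sum>k. diffs (\<lambda>k. c k $ i) k * t ^ k) = (\<Sum>k. \<Sum>j\<in>UNIV. A $ i $ j * (c k $ j * t ^ k))"
      by (simp only: diffs_c)
        (simp add: matrix_vector_mult_def sum_distrib_right mult.assoc)
    also have "\<dots> = (\<Sum>j\<in>UNIV. \<Sum>k. A $ i $ j * (c k $ j * t ^ k))"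
      by (intro suminf_sum summable_mult summ)
    also have "\<dots> = (\<Sum>j\<in>UNIV. A $ i $ j * x t $ j)"
      by (simp add: suminf_mult[OF summ] x_def)
    finally show ?thesis by (simp add: matrix_vector_mult_def)
  qed
  have "((\<lambda>s. x s $ i) has_real_derivative (A *v x t) $ i) (at t)" for i t
    using termdiffs_strong_converges_everywhere[of "\<lambda>k. c k $ i" t, OF summ]
    by (simp add: x_def[of "_::real", THEN arg_cong[where f = "\<lambda>v. v $ i"]] deriv_sum)
  then have "(x has_vector_derivative A *v x t) (at t)" for t
    unfolding has_vector_derivative_def has_derivative_componentwise_within
      [of _ "\<lambda>s. s *\<^sub>R (A *v x t)"]
    by (auto simp: Basis_vec_def inner_axis has_field_derivative_def mult_commute_abs)
  moreover have "x 0 = x0"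
    by (simp add: x_def vec_eq_iff c0 powser_zero)
  ultimately show ?thesis using that by blast
qed

lemma symmetric_matrix_inner_commute:
  "symmetric_matrix Q \<Longrightarrow> u \<bullet> (Q *v v) = v \<bullet> (Q *v u)"
  by (metis symmetric_matrix_def dot_lmul_matrix inner_commute transpose_matrix_vector)

lemma positive_definite_nonneg:
  "positive_definite Q \<Longrightarrow> 0 \<le> x \<bullet> (Q *v x)"
  by (cases "x = 0") (auto simp: positive_definite_def less_imp_le)

text \<open>
  The bound \<open>V \<le> 1\<close> along a trajectory constrains the derivative of \<open>V\<close> only at a boundary
  point of the ellipsoid.  Since the claim is homogeneous of degree 2, every \<open>x \<noteq> 0\<close> is rescaled to such a
  point \<open>z\<close>.
\<close>

lemma invariant_ellipsoid_imp_dissipative: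
  fixes A Q :: "real ^ 'n ^ 'n"
  assumes sym: "symmetric_matrix Q" and pd: "positive_definite Q"
    and inv: "continuous_invariant A (ellipsoid Q)"
  shows "x \<bullet> (Q *v (A *v x)) \<le> 0"
proof (cases "x = 0")
  case False
  define r where "r = sqrt (x \<bullet> (Q *v x))"
  have r: "r > 0" "r\<^sup>2 = x \<bullet> (Q *v x)"
    using pd False by (auto simp: r_def positive_definite_def less_imp_le)
  define z where "z = (1 / r) *\<^sub>R x"
  have z1: "z \<bullet> (Q *v z) = 1"
    using r by (simp add: z_def matrix_vector_mult_scaleR flip: r(2) power2_eq_square)
  obtain y where y0: "y 0 = z"
    and y': "\<And>t. (y has_vector_derivative A *v y t) (at t)"
    using exp_trajectory_exists[of z A] by blast
  have "continuous_trajectory A y"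
    unfolding continuous_trajectory_def using y' has_vector_derivative_at_within by blast
  then have stays: "y t \<bullet> (Q *v y t) \<le> 1" if "t \<ge> 0" for t
    using inv that z1 y0 by (auto simp: continuous_invariant_def ellipsoid_def)
  have Qy': "((\<lambda>t. Q *v y t) has_vector_derivative Q *v (A *v y t)) (at t)" for t
    by (rule bounded_linear.has_vector_derivative[OF matrix_vector_mul_bounded_linear y'])
  have "((\<lambda>t. y t \<bullet> (Q *v y t)) has_vector_derivative
      y 0 \<bullet> (Q *v (A *v y 0)) + (A *v y 0) \<bullet> (Q *v y 0)) (at 0)"
    by (rule bounded_bilinear.has_vector_derivative[OF bounded_bilinear_inner y' Qy'])
  then have der: "((\<lambda>t. y t \<bullet> (Q *v y t)) has_real_derivative 2 * (z \<bullet> (Q *v (A *v z)))) (at 0)"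
    by (simp add: has_real_derivative_iff_has_vector_derivative y0
        symmetric_matrix_inner_commute[OF sym, of "A *v z"])
  have "z \<bullet> (Q *v (A *v z)) \<le> 0"
  proof (rule ccontr)
    assume "\<not> ?thesis"
    then obtain d where "d > 0"
      and "\<And>h. 0 < h \<Longrightarrow> h < d \<Longrightarrow> y 0 \<bullet> (Q *v y 0) < y (0 + h) \<bullet> (Q *v y (0 + h))"
      using DERIV_pos_inc_right[OF der] by auto
    from this(2)[of "d / 2"] this(1) show False
      using stays[of "d / 2"] y0 z1 by simp
  qed
  then have "r\<^sup>2 * (z \<bullet> (Q *v (A *v z))) \<le> 0"
    by (simp add: mult_nonneg_nonpos)
  moreover have "r\<^sup>2 * (z \<bullet> (Q *v (A *v z))) = x \<bullet> (Q *v (A *v x))"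
    using r(1) by (simp add: z_def matrix_vector_mult_scaleR power2_eq_square)
  ultimately show ?thesis by simp
qed simp

lemma mat_1_minus_scaleR_mult_vector:
  fixes A :: "real ^ 'n ^ 'n"
  shows "(mat 1 - h *\<^sub>R A) *v x = x - h *\<^sub>R (A *v x)"
  by (simp add: matrix_vector_mult_diff_rdistrib scaleR_matrix_vector_assoc)

lemma matrix_mult_matrix_inv:
  assumes "invertible M"
  shows "M ** matrix_inv M = mat 1"
  using someI_ex[OF assms[unfolded invertible_def]] by (simp add: matrix_inv_def)

text \<open>
  An explicit step could increase the form, because it would add the term
  \<open>h\<^sup>2 (A y) \<bullet> Q (A y)\<close>; going backwards from the new point \<open>y\<close> to the old point \<open>w\<close>, this term and
  the dissipation term have the same favourable sign, whatever the size of \<open>h\<close>.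
\<close>

lemma dissipative_imp_le_resolvent:
  fixes A Q :: "real ^ 'n ^ 'n"
  assumes sym: "symmetric_matrix Q" and pd: "positive_definite Q"
    and diss: "y \<bullet> (Q *v (A *v y)) \<le> 0" and h: "h \<ge> 0"
  defines "w \<equiv> (mat 1 - h *\<^sub>R A) *v y"
  shows "y \<bullet> (Q *v y) \<le> w \<bullet> (Q *v w)"
proof -
  have "w \<bullet> (Q *v w) =
      y \<bullet> (Q *v y) - 2 * h * (y \<bullet> (Q *v (A *v y))) + h\<^sup>2 * ((A *v y) \<bullet> (Q *v (A *v y)))"
    unfolding w_def mat_1_minus_scaleR_mult_vector
    by (simp add: matrix_vector_mult_diff_distrib matrix_vector_mult_scaleR inner_diff_left
        inner_diff_right symmetric_matrix_inner_commute[OF sym, of "A *v y" y]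
        power2_eq_square algebra_simps)
  moreover have "h * (y \<bullet> (Q *v (A *v y))) \<le> 0"
    using diss h by (simp add: mult_nonneg_nonpos)
  moreover have "0 \<le> h\<^sup>2 * ((A *v y) \<bullet> (Q *v (A *v y)))"
    using positive_definite_nonneg[OF pd] by simp
  ultimately show ?thesis by linarith
qed

theorem theorem4p9:
  fixes A Q :: "real ^ 'n ^ 'n"
  assumes "symmetric_matrix Q"
    and "positive_definite Q"
    and "continuous_invariant A (ellipsoid Q)"
  shows "tau_bar A = \<infinity> \<and>
    (\<forall>\<Delta>t\<ge>0.
       invertible (mat 1 - \<Delta>t *\<^sub>R A) \<and>
       (\<forall>x\<in>ellipsoid Q. backward_euler A \<Delta>t *v x \<in> ellipsoid Q) \<and>
       discrete_invariant (backward_euler A \<Delta>t) (ellipsoid Q))"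
proof -
  note grow = dissipative_imp_le_resolvent[OF assms(1,2)
      invariant_ellipsoid_imp_dissipative[OF assms]]
  have inv: "invertible (mat 1 - h *\<^sub>R A)" if "h \<ge> 0" for h
  proof -
    have "y = 0" if "(mat 1 - h *\<^sub>R A) *v y = 0" for y
      using grow[OF \<open>h \<ge> 0\<close>, of y] that assms(2)
      by (auto simp: positive_definite_def not_less[symmetric])
    then show ?thesis
      by (simp add: invertible_left_inverse matrix_left_invertible_ker)
  qed
  have step: "backward_euler A h *v x \<in> ellipsoid Q" if "h \<ge> 0" "x \<in> ellipsoid Q" for h x
  proof -
    have "(mat 1 - h *\<^sub>R A) *v (backward_euler A h *v x) = x"
      using matrix_mult_matrix_inv[OF inv[OF that(1)]]
      by (simp add: backward_euler_def matrix_vector_mul_assoc)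
    then show ?thesis
      using grow[OF that(1), of "backward_euler A h *v x"] that(2)
      by (simp add: ellipsoid_def)
  qed
  have "tau_bar A = \<infinity>"
    unfolding tau_bar_def
  proof (rule SUP_PInfty)
    fix n :: nat
    show "\<exists>\<tau>\<in>{\<tau>. 0 \<le> \<tau> \<and> (\<forall>\<Delta>t\<in>{0..\<tau>}. invertible (mat 1 - \<Delta>t *\<^sub>R A))}.
        ereal (real n) \<le> ereal \<tau>"
      by (rule bexI[of _ "real n"]) (auto intro: inv)
  qed
  with inv step show ?thesis
    by (auto simp: discrete_invariant_def discrete_trajectory_def)
qed

end
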